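(* Consider the closed-loop system $x_{t+1}=A(\delta_t)x_t+B(\delta_t)u_t+w(\delta_t)$, $x_0=\bar x_0$, under the SCMPC feedback law $u_t:=u'_{0|t}$ described in the context. Suppose that the assumptions on the uncertainty, on the control problem, and on resolvability (all stated in the context) hold, and let $(K,R)$ be an admissible sample-removal pair for the level $\varepsilon\in(0,0.5)$. Let $M_t:=\mathbf 1_{\mathbb X^{\mathrm C}}(x_{t+1})$, i.e. $M_t=1$ if $x_{t+1}\notin\mathbb X$ and $M_t=0$ otherwise. Then $$\limsup_{T\to\infty}\frac1T\sum_{t=0}^{T-1}M_t\le\varepsilon$$ almost surely.
   Context: **System.** $x_{t+1}=A(\delta_t)x_t+B(\delta_t)u_t+w(\delta_t)$ with fixed $x_0=\bar x_0\in\mathbb R^n$, where $A(\cdot)\in\mathbb R^{n\times n}$, $B(\cdot)\in\mathbb R^{n\times m}$, $w(\cdot)\in\mathbb R^n$ are known functions of the uncertainty $\delta_t$. Inputs must lie in $\mathbb U\subset\mathbb R^m$; $\mathbb X\subset\mathbb R^n$ is the state constraint set; $\ell:\mathbb R^n\times\mathbb R^m\to[0,\infty)$ is the stage cost; $N\ge1$ is the prediction horizon. **Assumption (uncertainty).** $\delta_0,\delta_1,\dots$ are i.i.d. random variables on a probability space $(\Delta,\mathbf P)$ (each with law $\mathbf P$), and sufficiently many i.i.d. samples of $\delta_t$ can be drawn. Every relevant subset is assumed measurable. **Assumption (control problem).** The state $x_t$ is measured at each $t$; $\mathbb U$ is bounded and convex; $\mathbb X$ is convex; $\ell$ is convex.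 **Scenarios and removal.** At each time $t$, draw i.i.d. samples $\delta^{(k)}_{i|t}\sim\mathbf P$, $i=0,\dots,N-1$, $k=1,\dots,K$, independent over all $t,i,k$ and of $\{\delta_s\}_{s\ge0}$. The $k$-th scenario is $\omega^{(k)}_t:=\{\delta^{(k)}_{0|t},\dots,\delta^{(k)}_{N-1|t}\}$. For $R\ge0$, a removal algorithm is, for each $\xi\in\mathbb R^n$, a deterministic function $\mathcal A_\xi:\Delta^{NK}\to\Delta^{N(K-R)}$ selecting $K-R$ of the $K$ scenarios; at time $t$, $\mathcal A_{x_t}$ is used (for $R=0$ all scenarios are kept). $(K,R)$ is called a sample-removal pair. **Finite-horizon scenario program (FHSCP) at time $t$.** Minimize over $u_{0|t},\dots,u_{N-1|t}$ the cost $\sum_{k=1}^K\sum_{i=0}^{N-1}\ell(x^{(k)}_{i|t},u_{i|t})$, where $x^{(k)}_{0|t}=x_t$ and $x^{(k)}_{i+1|t}=A(\delta^{(k)}_{i|t})x^{(k)}_{i|t}+B(\delta^{(k)}_{i|t})u_{i|t}+w(\delta^{(k)}_{i|t})$, subject to $u_{i|t}\in\mathbb U$ for $i=0,\dots,N-1$ and $x^{(k)}_{i+1|t}\in\mathbb X$ for $i=0,\dots,N-1$ and all selected (non-removed) scenarios $k$. Its optimal solution $\{u'_{0|t},\dots,u'_{N-1|t}\}$ is the scenario solution, a (measurable) function of $x_t$ and the scenarios drawn at time $t$. SCMPC law: $u_t:=u'_{0|t}$. **Assumption (resolvability).** Under SCMPC, the FHSCP admits a feasible solution at every time $t$ almost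 surely. **Probability notation.** $\Omega_t\in\Delta^{KN}$ denotes the scenarios at time $t$. $\mathbf P^{j}$ is the $j$-fold product of $\mathbf P$ and $\mathbf E^{j}$ the corresponding expectation. "Almost surely" refers to the joint law of all $\delta_t,\Omega_t$, $t\ge0$. **Violation probability.** $V_t|x_t(\Omega_t):=\mathbf P\bigl[A(\delta_t)x_t+B(\delta_t)u'_{0|t}+w(\delta_t)\notin\mathbb X\mid x_t\bigr]$ (probability over $\delta_t$ only, for given $x_t$ and $\Omega_t$). For a fixed $x_t$, $\mathbf E^{KN}[V_t\mid x_t]:=\int_{\Delta^{KN}}V_t|x_t(\Omega_t)\,d\mathbf P^{KN}$. **Support rank $\rho_1$.** The unconstrained subspace of the state constraint on $x_{1|t}$ is the largest linear subspace $\mathcal L\subset\mathbb R^{Nm}$ of the space of decision vectors $(u_{0|t},\dots,u_{N-1|t})$ that is unconstrained by almost every sampled instance of this constraint (i.e. adding any element of $\mathcal L$ to a decision vector does not change whether the sampled constraint is satisfied). The support rank is $\rho_1:=Nm-\dim\mathcal L$. **Admissible pair.** Let $$U_{K,R,\rho_1}(\nu):=\min\Bigl\{1,\binom{R+\rho_1-1}{R}\sum_{j=0}^{R+\rho_1-1}\binom Kj\nu^j(1-\nu)^{K-j}\Bigr\},\quad\nu\in[0,1].$$ $(K,R)$ is admissible if its substitution into the bound $\mathbf E^{KN}[V_t\mid x_t]\le\int_0^1U_{K,R,\rho_1}(\nu)\,d\nu$ yields $\mathbf E^{KN}[V_t\mid x_t]\le\varepsilon$; that is, $\mathbf E^{KN}[V_t\mid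 x_t]\le\int_0^1U_{K,R,\rho_1}(\nu)\,d\nu\le\varepsilon$ for every state $x_t\in\mathbb R^n$ at which the FHSCP is almost surely feasible. *)

theory Defs
  imports "HOL-Probability.Probability" "HOL-Analysis.Finite_Function_Topology"
begin

definition affine_step ::
  "('d \<Rightarrow> real^'n^'n) \<Rightarrow> ('d \<Rightarrow> real^'m^'n) \<Rightarrow> ('d \<Rightarrow> real^'n) \<Rightarrow> 'd \<Rightarrow> real^'n \<Rightarrow> real^'m \<Rightarrow> real^'n"
  where "affine_step A B w d x u = A d *v x + B d *v u + w d"

text \<open>
  Below, \<open>f d x u\<close> is the successor of the state \<open>x\<close> under the input \<open>u\<close> and the
  uncertainty \<open>d\<close>; it is always instantiated with an \<^const>\<open>affine_step\<close>.

  A decision vector of the finite-horizon program is a finitely supported sequence of inputs that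
  vanishes from index \<open>N\<close> on.  The library's real vector space structure on finitely supported
  functions then makes \<open>decision_space N\<close> a copy of the \<open>N * m\<close>-dimensional Euclidean space
  (see \<open>dim_decision_space\<close>) in which \<^const>\<open>subspace\<close> and \<^const>\<open>dim\<close> are available
  although \<open>N\<close> is a term.
\<close>

type_synonym 'm inputs = "(nat, real^'m) poly_mapping"

abbreviation input :: "'m::finite inputs \<Rightarrow> nat \<Rightarrow> real^'m"
  where "input \<equiv> Poly_Mapping.lookup"

definition decision_space :: "nat \<Rightarrow> 'm::finite inputs set"
  where "decision_space N = {u. Poly_Mapping.keys u \<subseteq> {..<N}}"

lemma lookup_scaleR: "Poly_Mapping.lookup (c *\<^sub>R u) i = c *\<^sub>R Poly_Mapping.lookup u i"
  for u :: "('a, 'b::real_vector) poly_mapping"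
proof -
  have "finite {i. c *\<^sub>R Poly_Mapping.lookup u i \<noteq> 0}"
    by (rule finite_subset[OF _ finite_lookup[of u]]) auto
  then show ?thesis
    by (simp add: scaleR_poly_mapping_def lookup_Abs_poly_mapping)
qed

lemma mem_decision_space: "u \<in> decision_space N \<longleftrightarrow> (\<forall>i\<ge>N. input u i = 0)"
  by (auto simp: decision_space_def in_keys_iff subset_iff not_less[symmetric])

lemma subspace_decision_space: "subspace (decision_space N :: 'm::finite inputs set)"
  by (auto simp: subspace_def mem_decision_space lookup_add lookup_scaleR)

lemma dim_decision_space: "dim (decision_space N :: 'm::finite inputs set) = N * CARD('m)"
proof -
  define e :: "nat \<times> 'm \<Rightarrow> 'm inputs" where "e = (\<lambda>(i, j). Poly_Mapping.single i (axis j 1))"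
  let ?I = "{..<N} \<times> (UNIV :: 'm set)"
  have e: "input (e (i, j)) i' $ j' = (if i' = i \<and> j' = j then 1 else 0)" for i j i' j'
    by (auto simp: e_def lookup_single when_def axis_def)
  have inj: "inj_on e ?I"
  proof (rule inj_onI, clarify)
    fix i j i' j' assume "e (i, j) = e (i', j')"
    then show "i = i' \<and> j = j'" using e[of i j i j] e[of i' j' i j] by (auto split: if_splits)
  qed
  have indep: "independent (e ` ?I)"
    unfolding dependent_def
  proof (clarsimp)
    fix i j assume *: "e (i, j) \<in> span (e ` ?I - {e (i, j)})"
    have "input u i $ j = 0" if "u \<in> span (e ` ?I - {e (i, j)})" for u
      using that
    proof (induction rule: span_induct)
      case base
      show ?case by (auto simp: subspace_def lookup_add lookup_scaleR)
    next
      case (step u)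
      then show ?case by (auto simp: e)
    qed
    from this[OF *] show False by (simp add: e)
  qed
  have "u \<in> span (e ` ?I)" if u: "u \<in> decision_space N" for u
  proof -
    have "u = (\<Sum>p\<in>?I. (input u (fst p) $ snd p) *\<^sub>R e p)"
    proof (intro poly_mapping_eqI vec_eq_iff[THEN iffD2] allI)
      fix i j
      have "input (\<Sum>p\<in>?I. (input u (fst p) $ snd p) *\<^sub>R e p) i $ j =
          (\<Sum>p\<in>?I. if (i, j) = p then input u i $ j else 0)"
        by (simp only: lookup_sum sum_component lookup_scaleR vector_scaleR_component)
          (rule sum.cong, auto simp: e split: if_splits)
      also have "\<dots> = input u i $ j"
        using u by (subst sum.delta') (auto simp: mem_decision_space not_less)
      finally show "input u i $ j = input (\<Sum>p\<in>?I. (input u (fst p) $ snd p) *\<^sub>R e p) i $ j" ..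
    qed
    also have "\<dots> \<in> span (e ` ?I)"
      by (intro span_sum span_scale span_base) auto
    finally show ?thesis .
  qed
  moreover have "e ` ?I \<subseteq> decision_space N"
    by (auto simp: mem_decision_space e vec_eq_iff)
  ultimately have "dim (decision_space N :: 'm inputs set) = card (e ` ?I)"
    using indep by (intro dim_unique) auto
  then show ?thesis
    using inj by (simp add: card_image)
qed

text \<open>
  \<open>om (k, i)\<close> is the \<open>i\<close>-th uncertainty of the \<open>k\<close>-th scenario.
\<close>

type_synonym 'd scenarios = "nat \<times> nat \<Rightarrow> 'd"

definition scenario_space :: "'d measure \<Rightarrow> nat \<Rightarrow> nat \<Rightarrow> 'd scenarios measure"
  where "scenario_space P N K = PiM ({1..K} \<times> {..<N}) (\<lambda>_. P)"

primrec predicted ::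
  "('d \<Rightarrow> real^'n \<Rightarrow> real^'m \<Rightarrow> real^'n) \<Rightarrow> 'd scenarios \<Rightarrow> nat \<Rightarrow> real^'n \<Rightarrow> 'm::finite inputs \<Rightarrow> nat \<Rightarrow> real^'n"
  where
    "predicted f om k x u 0 = x"
  | "predicted f om k x u (Suc i) = f (om (k, i)) (predicted f om k x u i) (input u i)"

definition fhscp_cost ::
  "('d \<Rightarrow> real^'n \<Rightarrow> real^'m \<Rightarrow> real^'n) \<Rightarrow> ((real^'n) \<times> (real^'m) \<Rightarrow> real) \<Rightarrow> nat \<Rightarrow> nat
    \<Rightarrow> real^'n \<Rightarrow> 'd scenarios \<Rightarrow> 'm::finite inputs \<Rightarrow> real"
  where "fhscp_cost f l N K x om u = (\<Sum>k=1..K. \<Sum>i<N. l (predicted f om k x u i, input u i))"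

text \<open>
  A removal algorithm \<open>rem\<close> is rendered by the indices of the scenarios that it keeps.
\<close>

definition removal_algorithm ::
  "'d measure \<Rightarrow> nat \<Rightarrow> nat \<Rightarrow> nat \<Rightarrow> (real^'n \<Rightarrow> 'd scenarios \<Rightarrow> nat set) \<Rightarrow> bool"
  where "removal_algorithm P N K R rem \<longleftrightarrow>
    R \<le> K \<and>
    (\<forall>x. \<forall>om\<in>space (scenario_space P N K). rem x om \<subseteq> {1..K} \<and> card (rem x om) = K - R) \<and>
    (\<lambda>(x, om). rem x om) \<in> borel \<Otimes>\<^sub>M scenario_space P N K \<rightarrow>\<^sub>M count_space (Pow {1..K})"

definition fhscp_feasible ::
  "('d \<Rightarrow> real^'n \<Rightarrow> real^'m \<Rightarrow> real^'n) \<Rightarrow> (real^'n) set \<Rightarrow> (real^'m) set \<Rightarrow> nat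
    \<Rightarrow> (real^'n \<Rightarrow> 'd scenarios \<Rightarrow> nat set) \<Rightarrow> real^'n \<Rightarrow> 'd scenarios \<Rightarrow> 'm::finite inputs set"
  where "fhscp_feasible f X U N rem x om =
    {u \<in> decision_space N.
      (\<forall>i<N. input u i \<in> U) \<and>
      (\<forall>k\<in>rem x om. \<forall>i<N. predicted f om k x u (Suc i) \<in> X)}"

definition fhscp_optimal ::
  "('d \<Rightarrow> real^'n \<Rightarrow> real^'m \<Rightarrow> real^'n) \<Rightarrow> (real^'n) set \<Rightarrow> (real^'m) set \<Rightarrow> ((real^'n) \<times> (real^'m) \<Rightarrow> real)
    \<Rightarrow> nat \<Rightarrow> nat \<Rightarrow> (real^'n \<Rightarrow> 'd scenarios \<Rightarrow> nat set) \<Rightarrow> real^'n \<Rightarrow> 'd scenarios \<Rightarrow> 'm::finite inputs \<Rightarrow> bool"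
  where "fhscp_optimal f X U l N K rem x om u \<longleftrightarrow>
    u \<in> fhscp_feasible f X U N rem x om \<and>
    (\<forall>v\<in>fhscp_feasible f X U N rem x om. fhscp_cost f l N K x om u \<le> fhscp_cost f l N K x om v)"

text \<open>
  The scenario solution is only constrained where the program is feasible; elsewhere its value is
  an irrelevant default.
\<close>

definition scenario_solution ::
  "'d measure \<Rightarrow> ('d \<Rightarrow> real^'n \<Rightarrow> real^'m \<Rightarrow> real^'n) \<Rightarrow> (real^'n) set \<Rightarrow> (real^'m) set \<Rightarrow> ((real^'n) \<times> (real^'m) \<Rightarrow> real)
    \<Rightarrow> nat \<Rightarrow> nat \<Rightarrow> (real^'n \<Rightarrow> 'd scenarios \<Rightarrow> nat set) \<Rightarrow> (real^'n \<Rightarrow> 'd scenarios \<Rightarrow> 'm::finite inputs) \<Rightarrow> bool"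
  where "scenario_solution P f X U l N K rem sol \<longleftrightarrow>
    (\<forall>x. \<forall>om\<in>space (scenario_space P N K).
      fhscp_feasible f X U N rem x om \<noteq> {} \<longrightarrow> fhscp_optimal f X U l N K rem x om (sol x om)) \<and>
    (\<forall>i<N. (\<lambda>(x, om). input (sol x om) i) \<in> borel_measurable (borel \<Otimes>\<^sub>M scenario_space P N K))"

text \<open>
  \<open>V\<close>, as a function of the current state and the scenarios drawn at the current time.
\<close>

definition violation_prob ::
  "'d measure \<Rightarrow> ('d \<Rightarrow> real^'n \<Rightarrow> real^'m \<Rightarrow> real^'n) \<Rightarrow> (real^'n) set
    \<Rightarrow> (real^'n \<Rightarrow> 'd scenarios \<Rightarrow> 'm::finite inputs) \<Rightarrow> real^'n \<Rightarrow> 'd scenarios \<Rightarrow> real"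
  where "violation_prob P f X sol x om = measure P {d \<in> space P. f d x (input (sol x om) 0) \<notin> X}"

text \<open>
  Linear subspaces of the decision space that are unconstrained by almost every instance of the
  constraint on the first predicted state, when the program is posed at the state \<open>x\<close>.
\<close>

definition unconstrained_subspace ::
  "'d measure \<Rightarrow> ('d \<Rightarrow> real^'n \<Rightarrow> real^'m \<Rightarrow> real^'n) \<Rightarrow> (real^'n) set \<Rightarrow> nat \<Rightarrow> real^'n \<Rightarrow> 'm::finite inputs set \<Rightarrow> bool"
  where "unconstrained_subspace P f X N x L \<longleftrightarrow>
    subspace L \<and> L \<subseteq> decision_space N \<and>
    (AE d in P. \<forall>u\<in>decision_space N. \<forall>v\<in>L. f d x (input (u + v) 0) \<in> X \<longleftrightarrow> f d x (input u 0) \<in> X)"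

lemma ex1_largest_unconstrained_subspace:
  fixes f :: "'d \<Rightarrow> real^'n \<Rightarrow> real^'m \<Rightarrow> real^'n"
  shows "\<exists>!L. unconstrained_subspace P f X N x L \<and>
    (\<forall>L'. unconstrained_subspace P f X N x L' \<longrightarrow> L' \<subseteq> L)"
proof -
  let ?Q = "unconstrained_subspace P f X N x"
  have dim_le: "dim L \<le> N * CARD('m)" and fin: "independent B \<Longrightarrow> B \<subseteq> L \<Longrightarrow> finite B"
    if "?Q L" for L B
  proof -
    obtain E :: "'m inputs set" where E: "E \<subseteq> decision_space N" "independent E"
        "decision_space N \<subseteq> span E" "card E = dim (decision_space N :: 'm inputs set)"
      using basis_exists by blast
    have "finite E"
    proof (cases "N = 0")
      case True
      then have "decision_space N \<subseteq> {0::'m inputs}"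
        by (auto simp: mem_decision_space intro: poly_mapping_eqI)
      with E(1) show ?thesis by (meson finite.emptyI finite_insert finite_subset)
    next
      case False
      with E(4) show ?thesis by (intro card_ge_0_finite) (simp add: dim_decision_space)
    qed
    moreover have "L \<subseteq> span E" using that E(3) by (auto simp: unconstrained_subspace_def)
    ultimately show "dim L \<le> N * CARD('m)" "independent B \<Longrightarrow> B \<subseteq> L \<Longrightarrow> finite B"
      using dim_le_card[of L E] E(4) independent_span_bound[of E B]
      by (auto simp: dim_decision_space)
  qed
  have "?Q {0}"
    by (auto simp: unconstrained_subspace_def mem_decision_space)
  then have "\<exists>L. ?Q L \<and> (\<forall>L'. ?Q L' \<longrightarrow> dim L' \<le> dim L)"
    by (rule ex_has_greatest_nat[where b = "Suc (N * CARD('m))"]) (simp add: dim_le less_Suc_eq_le)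
  then obtain L where L: "?Q L" and max: "\<And>L'. ?Q L' \<Longrightarrow> dim L' \<le> dim L"
    by blast
  have "L' \<subseteq> L" if L': "?Q L'" for L'
  proof -
    define M where "M = {a + b | a b. a \<in> L \<and> b \<in> L'}"
    have "subspace M" "M \<subseteq> decision_space N"
      using L L' subspace_sums[of L L'] subspace_add[OF subspace_decision_space, of _ N]
      by (auto simp: M_def unconstrained_subspace_def)
    moreover have "AE d in P. \<forall>u\<in>decision_space N. \<forall>v\<in>M. f d x (input (u + v) 0) \<in> X \<longleftrightarrow> f d x (input u 0) \<in> X"
      using L[unfolded unconstrained_subspace_def, THEN conjunct2, THEN conjunct2]
        L'[unfolded unconstrained_subspace_def, THEN conjunct2, THEN conjunct2]
    proof eventually_elim
      case (elim d)
      have "u + a \<in> decision_space N" if "u \<in> decision_space N" "a \<in> L" for u a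
        using that L subspace_add[OF subspace_decision_space, of _ N]
        by (auto simp: unconstrained_subspace_def)
      with elim show ?case
        unfolding M_def by (auto simp: add.assoc[symmetric])
    qed
    ultimately have M: "?Q M"
      by (simp add: unconstrained_subspace_def)
    have "0 \<in> L" "0 \<in> L'"
      using L L' by (auto simp: unconstrained_subspace_def subspace_0)
    then have sub: "L \<subseteq> M" "L' \<subseteq> M"
      unfolding M_def using add_0_right add_0_left by (blast intro: sym)+
    obtain B where B: "B \<subseteq> L" "independent B" "L \<subseteq> span B" "card B = dim L"
      using basis_exists by blast
    obtain C where C: "B \<subseteq> C" "C \<subseteq> M" "independent C" "M \<subseteq> span C"
      using maximal_independent_subset_extend[of B M] B sub by blast
    have "card C = dim M" "finite C"
      using C basis_card_eq_dim[of C M] fin[OF M] by auto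
    then have "B = C"
      using C(1) max[OF M] B(4) by (intro card_seteq) auto
    then have "M \<subseteq> L"
      using C B L span_minimal[of B L] by (auto simp: unconstrained_subspace_def)
    with sub show ?thesis by blast
  qed
  with L show ?thesis by blast
qed

definition largest_unconstrained_subspace ::
  "'d measure \<Rightarrow> ('d \<Rightarrow> real^'n \<Rightarrow> real^'m \<Rightarrow> real^'n) \<Rightarrow> (real^'n) set \<Rightarrow> nat \<Rightarrow> real^'n \<Rightarrow> 'm::finite inputs set"
  where "largest_unconstrained_subspace P f X N x =
    (THE L. unconstrained_subspace P f X N x L \<and> (\<forall>L'. unconstrained_subspace P f X N x L' \<longrightarrow> L' \<subseteq> L))"

definition support_rank ::
  "'d measure \<Rightarrow> ('d \<Rightarrow> real^'n \<Rightarrow> real^'m \<Rightarrow> real^'n) \<Rightarrow> (real^'n) set \<Rightarrow> nat \<Rightarrow> real^'n \<Rightarrow> nat"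
  where "support_rank P f X N x =
    N * CARD('m) - dim (largest_unconstrained_subspace P f X N x :: 'm::finite inputs set)"

text \<open>
  The sum over \<open>j = 0, ..., R + \<rho> - 1\<close> is written over \<open>{..<R + \<rho>}\<close>, so that it is empty (and
  not truncated to \<open>j = 0\<close>) if \<open>R = \<rho> = 0\<close>.
\<close>

definition U_bound :: "nat \<Rightarrow> nat \<Rightarrow> nat \<Rightarrow> real \<Rightarrow> real"
  where "U_bound K R \<rho> \<nu> =
    min 1 (real ((R + \<rho> - 1) choose R) * (\<Sum>j<R + \<rho>. real (K choose j) * \<nu> ^ j * (1 - \<nu>) ^ (K - j)))"

definition admissible_pair ::
  "'d measure \<Rightarrow> ('d \<Rightarrow> real^'n \<Rightarrow> real^'m \<Rightarrow> real^'n) \<Rightarrow> (real^'n) set \<Rightarrow> (real^'m) set \<Rightarrow> nat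
    \<Rightarrow> (real^'n \<Rightarrow> 'd scenarios \<Rightarrow> nat set) \<Rightarrow> (real^'n \<Rightarrow> 'd scenarios \<Rightarrow> 'm::finite inputs)
    \<Rightarrow> real \<Rightarrow> nat \<Rightarrow> nat \<Rightarrow> bool"
  where "admissible_pair P f X U N rem sol \<epsilon> K R \<longleftrightarrow>
    (\<forall>x. (AE om in scenario_space P N K. fhscp_feasible f X U N rem x om \<noteq> {}) \<longrightarrow>
      (\<integral>om. violation_prob P f X sol x om \<partial>scenario_space P N K)
        \<le> integral {0..1} (U_bound K R (support_rank P f X N x)) \<and>
      integral {0..1} (U_bound K R (support_rank P f X N x)) \<le> \<epsilon>)"

text \<open>
  One realization of the closed loop: \<open>d t\<close> is the uncertainty acting on the plant at time \<open>t\<close>,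
  \<open>om t\<close> the scenarios drawn at time \<open>t\<close>.
\<close>

primrec closed_loop ::
  "('d \<Rightarrow> real^'n \<Rightarrow> real^'m \<Rightarrow> real^'n) \<Rightarrow> (real^'n \<Rightarrow> 'd scenarios \<Rightarrow> 'm::finite inputs)
    \<Rightarrow> real^'n \<Rightarrow> (nat \<Rightarrow> 'd) \<Rightarrow> (nat \<Rightarrow> 'd scenarios) \<Rightarrow> nat \<Rightarrow> real^'n"
  where
    "closed_loop f sol x0 d om 0 = x0"
  | "closed_loop f sol x0 d om (Suc t) =
      f (d t) (closed_loop f sol x0 d om t) (input (sol (closed_loop f sol x0 d om t) (om t)) 0)"

text \<open>
  Index type of all random draws: \<open>Plant t\<close> for the uncertainty at time \<open>t\<close>, and \<open>Sample t k i\<close>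
  for the \<open>i\<close>-th uncertainty of the \<open>k\<close>-th scenario drawn at time \<open>t\<close>.
\<close>

datatype draw = Plant nat | Sample nat nat nat

definition draws :: "nat \<Rightarrow> nat \<Rightarrow> draw set"
  where "draws N K = range Plant \<union> {Sample t k i | t k i. k \<in> {1..K} \<and> i < N}"

definition drawn_scenarios :: "nat \<Rightarrow> nat \<Rightarrow> (draw \<Rightarrow> 's \<Rightarrow> 'd) \<Rightarrow> nat \<Rightarrow> 's \<Rightarrow> 'd scenarios"
  where "drawn_scenarios N K \<delta> t s = (\<lambda>(k, i)\<in>{1..K} \<times> {..<N}. \<delta> (Sample t k i) s)"

definition scmpc_state ::
  "('d \<Rightarrow> real^'n \<Rightarrow> real^'m \<Rightarrow> real^'n) \<Rightarrow> (real^'n \<Rightarrow> 'd scenarios \<Rightarrow> 'm::finite inputs) \<Rightarrow> nat \<Rightarrow> nat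
    \<Rightarrow> real^'n \<Rightarrow> (draw \<Rightarrow> 's \<Rightarrow> 'd) \<Rightarrow> nat \<Rightarrow> 's \<Rightarrow> real^'n"
  where "scmpc_state f sol N K x0 \<delta> t s =
    closed_loop f sol x0 (\<lambda>t. \<delta> (Plant t) s) (\<lambda>t. drawn_scenarios N K \<delta> t s) t"

end

theory Submission
  imports Defs
begin

text \<open>
  At time \<open>t\<close> the state is a function of the earlier draws, and the scenarios and the plant
  uncertainty of time \<open>t\<close> are independent of these.  Hence, given the past, a violation occurs
  with the expected violation probability at the current state, which admissibility bounds by
  \<open>\<epsilon>\<close>: resolvability and Fubini make the program posed at almost every reached state almost
  surely feasible.  So each step multiplies the moment generating function of the number of
  violations by at most \<open>1 + \<epsilon> (exp a - 1)\<close>.  A Chernoff bound at \<open>a = \<eta>\<close> makes the probability of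
  at least \<open>T (\<epsilon> + \<eta>)\<close> violations up to time \<open>T\<close> geometrically small, and Borel--Cantelli concludes.
  In this way neither conditional expectations nor a law of large numbers for martingales is needed.
\<close>

section \<open>Frequencies of dependent events: Chernoff bound and Borel-Cantelli\<close>

text \<open>The hypothesis \<open>step\<close> replaces a bound on the conditional probability of
  \<open>E t\<close> given the past: it is tested only against the exponential weights of the
  earlier count, which is exactly what the induction for the moment generating function
  consumes.\<close>

lemma (in prob_space) AE_limsup_frequency_le:
  fixes E :: "nat \<Rightarrow> 'a set" and \<epsilon> :: real
  assumes E[measurable]: "\<And>t. E t \<in> events" and \<epsilon>: "0 \<le> \<epsilon>" "\<epsilon> < 1"
    and step: "\<And>t a. 0 \<le> a \<Longrightarrow>
      (\<integral>\<^sup>+s. ennreal (exp (a * (\<Sum>i<t. indicator (E i) s))) * indicator (E t) s \<partial>M)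
        \<le> ennreal \<epsilon> * (\<integral>\<^sup>+s. ennreal (exp (a * (\<Sum>i<t. indicator (E i) s))) \<partial>M)"
  shows "AE s in M. limsup (\<lambda>T. ereal (1 / real T * (\<Sum>t<T. indicator (E t) s))) \<le> ereal \<epsilon>"
proof -
  define c :: "nat \<Rightarrow> 'a \<Rightarrow> real" where "c T s = (\<Sum>t<T. indicator (E t) s)" for T s
  have [measurable]: "c T \<in> borel_measurable M" for T
    unfolding c_def by measurable
  have mgf: "(\<integral>\<^sup>+s. ennreal (exp (a * c T s)) \<partial>M) \<le> ennreal ((1 + \<epsilon> * (exp a - 1)) ^ T)"
    if a: "0 \<le> a" for a T
  proof (induction T)
    case 0
    show ?case by (simp add: c_def emeasure_space_1)
  next
    case (Suc T)
    have ge: "0 \<le> exp a - 1" using a by simp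
    have "(\<integral>\<^sup>+s. ennreal (exp (a * c (Suc T) s)) \<partial>M) =
        (\<integral>\<^sup>+s. ennreal (exp (a * c T s)) +
          ennreal (exp a - 1) * (ennreal (exp (a * c T s)) * indicator (E T) s) \<partial>M)"
    proof (rule nn_integral_cong)
      fix s
      \<comment> \<open>Because an indicator is 0 or 1, the extra factor exp (a * 1_E) is the affine
        expression 1 + (exp a - 1) * 1_E. This makes the recursion linear in the weighted indicator,
        so that \<open>step\<close> applies.\<close>
      have "exp (a * c (Suc T) s) =
          exp (a * c T s) + (exp a - 1) * (exp (a * c T s) * indicator (E T) s)"
        by (cases "s \<in> E T") (simp_all add: c_def exp_add algebra_simps)
      then show "ennreal (exp (a * c (Suc T) s)) = ennreal (exp (a * c T s)) +
          ennreal (exp a - 1) * (ennreal (exp (a * c T s)) * indicator (E T) s)"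
        using ge by (simp add: ennreal_plus ennreal_mult ennreal_indicator)
    qed
    also have "\<dots> = (\<integral>\<^sup>+s. ennreal (exp (a * c T s)) \<partial>M) +
        ennreal (exp a - 1) * (\<integral>\<^sup>+s. ennreal (exp (a * c T s)) * indicator (E T) s \<partial>M)"
      by (simp add: nn_integral_add nn_integral_cmult)
    also have "\<dots> \<le> (\<integral>\<^sup>+s. ennreal (exp (a * c T s)) \<partial>M) +
        ennreal (exp a - 1) * (ennreal \<epsilon> * (\<integral>\<^sup>+s. ennreal (exp (a * c T s)) \<partial>M))"
      using step[OF a, of T] by (intro add_left_mono mult_left_mono) (simp_all add: c_def)
    also have "\<dots> = ennreal (1 + \<epsilon> * (exp a - 1)) * (\<integral>\<^sup>+s. ennreal (exp (a * c T s)) \<partial>M)"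
      using ge \<epsilon> by (simp add: ennreal_plus ennreal_mult distrib_right mult_ac)
    also have "\<dots> \<le> ennreal (1 + \<epsilon> * (exp a - 1)) * ennreal ((1 + \<epsilon> * (exp a - 1)) ^ T)"
      by (intro mult_left_mono Suc.IH) simp
    also have "\<dots> = ennreal ((1 + \<epsilon> * (exp a - 1)) ^ Suc T)"
      using ge \<epsilon> by (simp add: ennreal_mult)
    finally show ?case .
  qed
  have eventually_le: "AE s in M. eventually (\<lambda>T. c T s \<le> real T * (\<epsilon> + \<eta>)) sequentially"
    if \<eta>: "0 < \<eta>" "\<eta> \<le> 1" for \<eta>
  proof -
    \<comment> \<open>\<open>q\<close> bounds the factor gained per time step in the Chernoff bound
      at a = \<eta>. As \<eta> \<le> 1, exp \<eta> \<le> 1 + \<eta> + \<eta>^2; with 1 + z \<le> exp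
      z the logarithm of \<open>q\<close> is at most -\<eta> (\<epsilon> + \<eta>) + \<epsilon>
      (\<eta> + \<eta>^2) = -\<eta>^2 (1 - \<epsilon>). The terms linear in \<eta> cancel, and
      \<epsilon> < 1 makes the rest negative.\<close>
    define q where "q = exp (- \<eta> * (\<epsilon> + \<eta>)) * (1 + \<epsilon> * (exp \<eta> - 1))"
    have q0: "0 \<le> q"
      using \<eta> \<epsilon> by (simp add: q_def)
    have "exp \<eta> - 1 \<le> \<eta> + \<eta>\<^sup>2"
      using exp_bound[of \<eta>] \<eta> by simp
    then have "\<epsilon> * (exp \<eta> - 1) \<le> \<epsilon> * (\<eta> + \<eta>\<^sup>2)"
      using \<epsilon> by (intro mult_left_mono)
    then have "1 + \<epsilon> * (exp \<eta> - 1) \<le> exp (\<epsilon> * (\<eta> + \<eta>\<^sup>2))"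
      using exp_ge_add_one_self[of "\<epsilon> * (\<eta> + \<eta>\<^sup>2)"] by linarith
    then have "q \<le> exp (- \<eta> * (\<epsilon> + \<eta>)) * exp (\<epsilon> * (\<eta> + \<eta>\<^sup>2))"
      unfolding q_def by (intro mult_left_mono) auto
    also have "\<dots> = exp (- (\<eta>\<^sup>2 * (1 - \<epsilon>)))"
      by (simp add: exp_add[symmetric] algebra_simps power2_eq_square)
    also have "\<dots> < 1"
      using \<eta> \<epsilon> by simp
    finally have q1: "q < 1" .
    let ?B = "\<lambda>T. {s \<in> space M. real T * (\<epsilon> + \<eta>) \<le> c T s}"
    have B: "emeasure M (?B T) \<le> ennreal (q ^ T)" for T
    proof -
      \<comment> \<open>On the bad event the exponent \<eta> * (c T s - T * (\<epsilon> + \<eta>))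
        is nonnegative. The deterministic factor is split off as a T-th power, to merge later with
        the bound \<open>mgf\<close> into q^T.\<close>
      have "1 \<le> exp (- \<eta> * (\<epsilon> + \<eta>)) ^ T * exp (\<eta> * c T s)" if "real T * (\<epsilon> + \<eta>) \<le> c T s" for s
        using mult_left_mono[OF that, of \<eta>] \<eta>
        by (simp add: exp_of_nat_mult[symmetric] exp_add[symmetric] algebra_simps)
      then have "?B T \<subseteq> {s \<in> space M.
          1 \<le> ennreal (exp (- \<eta> * (\<epsilon> + \<eta>)) ^ T) * ennreal (exp (\<eta> * c T s))}"
        by (auto simp: ennreal_mult[symmetric] simp del: mult_minus_left)
      then have "emeasure M (?B T) \<le> emeasure M {s \<in> space M.
          1 \<le> ennreal (exp (- \<eta> * (\<epsilon> + \<eta>)) ^ T) * ennreal (exp (\<eta> * c T s))}"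
        by (intro emeasure_mono) auto
      also have "\<dots> \<le> ennreal (exp (- \<eta> * (\<epsilon> + \<eta>)) ^ T) * (\<integral>\<^sup>+s. ennreal (exp (\<eta> * c T s)) \<partial>M)"
        using nn_integral_Markov_inequality[of "\<lambda>s. ennreal (exp (\<eta> * c T s))" "space M" M
            "ennreal (exp (- \<eta> * (\<epsilon> + \<eta>)) ^ T)"]
        by simp
      also have "\<dots> \<le> ennreal (exp (- \<eta> * (\<epsilon> + \<eta>)) ^ T) * ennreal ((1 + \<epsilon> * (exp \<eta> - 1)) ^ T)"
        using \<eta> by (intro mult_left_mono mgf) auto
      also have "\<dots> = ennreal (q ^ T)"
        using \<eta> \<epsilon> by (simp add: q_def power_mult_distrib ennreal_mult)
      finally show ?thesis .
    qed
    have "AE s in M. eventually (\<lambda>T. s \<in> space M - ?B T) sequentially"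
    proof (rule borel_cantelli_AE1)
      show "summable (\<lambda>T. measure M (?B T))"
      proof (rule summable_comparison_test')
        show "summable (\<lambda>T. q ^ T)"
          using q0 q1 by (simp add: summable_geometric)
        show "norm (measure M (?B T)) \<le> q ^ T" if "0 \<le> T" for T
          using B[of T] q0 by (simp add: emeasure_eq_measure)
      qed
    qed (auto simp: emeasure_eq_measure)
    then show ?thesis
      by (rule AE_mp) (auto elim!: eventually_mono intro!: AE_I2)
  qed
  \<comment> \<open>Countably many margins, all at most 1, suffice: their exceptional null sets can
    be united, and the margins tend to 0.\<close>
  have "AE s in M. \<forall>n. eventually (\<lambda>T. c T s \<le> real T * (\<epsilon> + inverse (real (Suc n)))) sequentially"
    unfolding AE_all_countable by (intro allI eventually_le) (auto simp: divide_simps)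
  then show ?thesis
  proof eventually_elim
    case (elim s)
    have le: "limsup (\<lambda>T. ereal (1 / real T * c T s)) \<le> ereal (\<epsilon> + inverse (real (Suc n)))" for n
    proof (rule Limsup_bounded)
      show "eventually (\<lambda>T. ereal (1 / real T * c T s) \<le> ereal (\<epsilon> + inverse (real (Suc n)))) sequentially"
        using elim[rule_format, of n] eventually_gt_at_top[of 0]
        by eventually_elim (simp add: field_simps)
    qed
    have "(\<lambda>n. ereal (\<epsilon> + inverse (real (Suc n)))) \<longlonglongrightarrow> ereal (\<epsilon> + 0)"
      by (intro tendsto_intros LIMSEQ_inverse_real_of_nat)
    then show ?case
      using le by (intro LIMSEQ_le_const[where X="\<lambda>n. ereal (\<epsilon> + inverse (real (Suc n)))"]) (auto simp: c_def)
  qed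
qed

text \<open>Here \<open>W\<close> stands for the past and \<open>Z\<close> for the present. As their
  joint law is a product, Fubini freezes the past at w, takes \<open>g w\<close> out of the inner
  integral and leaves the measure of a slice of \<open>E\<close>. The slice bound is asked for
  almost every w because resolvability makes the program feasible only at almost every reached
  state.\<close>

lemma (in prob_space) nn_integral_indep_indicator_le:
  assumes [measurable]: "W \<in> M \<rightarrow>\<^sub>M NW" "Z \<in> M \<rightarrow>\<^sub>M NZ"
    and joint: "distr M (NW \<Otimes>\<^sub>M NZ) (\<lambda>s. (W s, Z s)) = distr M NW W \<Otimes>\<^sub>M \<zeta>"
    and nz: "distr M NZ Z = \<zeta>"
    and E: "E \<in> sets (NW \<Otimes>\<^sub>M NZ)" and g[measurable]: "g \<in> borel_measurable NW"
    and le: "AE w in distr M NW W. emeasure \<zeta> (Pair w -` E) \<le> \<epsilon>"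
  shows "(\<integral>\<^sup>+s. g (W s) * indicator E (W s, Z s) \<partial>M) \<le> \<epsilon> * (\<integral>\<^sup>+s. g (W s) \<partial>M)"
proof -
  interpret W: prob_space "distr M NW W" by (rule prob_space_distr) simp
  interpret \<zeta>: prob_space \<zeta> unfolding nz[symmetric] by (rule prob_space_distr) simp
  have [measurable_cong]: "sets \<zeta> = sets NZ"
    unfolding nz[symmetric] by simp
  note [measurable] = E
  have "(\<integral>\<^sup>+s. g (W s) * indicator E (W s, Z s) \<partial>M) =
      (\<integral>\<^sup>+p. g (fst p) * indicator E p \<partial>distr M (NW \<Otimes>\<^sub>M NZ) (\<lambda>s. (W s, Z s)))"
    by (subst nn_integral_distr) auto
  also have "\<dots> = (\<integral>\<^sup>+w. \<integral>\<^sup>+z. g w * indicator E (w, z) \<partial>\<zeta> \<partial>distr M NW W)"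
    unfolding joint by (subst \<zeta>.nn_integral_fst[symmetric]) auto
  also have "\<dots> = (\<integral>\<^sup>+w. g w * emeasure \<zeta> (Pair w -` E) \<partial>distr M NW W)"
  proof (rule nn_integral_cong)
    fix w
    have [measurable]: "Pair w -` E \<in> sets \<zeta>"
      by (rule sets_Pair1[where ?M1.0 = NW]) simp
    have "(\<integral>\<^sup>+z. g w * indicator E (w, z) \<partial>\<zeta>) = (\<integral>\<^sup>+z. g w * indicator (Pair w -` E) z \<partial>\<zeta>)"
      by (simp add: indicator_def)
    then show "(\<integral>\<^sup>+z. g w * indicator E (w, z) \<partial>\<zeta>) = g w * emeasure \<zeta> (Pair w -` E)"
      by (simp add: nn_integral_cmult)
  qed
  also have "\<dots> \<le> (\<integral>\<^sup>+w. \<epsilon> * g w \<partial>distr M NW W)"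
    using le by (intro nn_integral_mono_AE) (auto elim!: eventually_mono simp: mult.commute[of \<epsilon>] intro!: mult_left_mono)
  also have "\<dots> = \<epsilon> * (\<integral>\<^sup>+s. g (W s) \<partial>M)"
    by (simp add: nn_integral_cmult nn_integral_distr)
  finally show ?thesis .
qed

section \<open>Measurability of the dynamics, the predictions and feasibility\<close>

lemma measurable_matrix_vector_mult [measurable (raw)]:
  fixes F :: "'a \<Rightarrow> real^'n^'m"
  assumes "F \<in> borel_measurable M" "g \<in> borel_measurable M"
  shows "(\<lambda>x. F x *v g x) \<in> borel_measurable M"
proof (rule borel_measurable_continuous_Pair[OF assms])
  show "continuous_on UNIV (\<lambda>p. fst p *v snd p :: real^'m)" 
    unfolding matrix_vector_mult_def by (intro continuous_intros)
qed

lemma measurable_affine_step [measurable (raw)]: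
  assumes [measurable]: "A \<in> borel_measurable P" "B \<in> borel_measurable P" "w \<in> borel_measurable P"
    and [measurable]: "d \<in> M \<rightarrow>\<^sub>M P" "x \<in> borel_measurable M" "u \<in> borel_measurable M"
  shows "(\<lambda>s. affine_step A B w (d s) (x s) (u s)) \<in> borel_measurable M"
  unfolding affine_step_def by measurable

lemma measurable_dynamics:
  fixes f :: "'d \<Rightarrow> real^'n \<Rightarrow> real^'m \<Rightarrow> real^'n"
  assumes f: "(\<lambda>(d, x, u). f d x u) \<in> borel_measurable (P \<Otimes>\<^sub>M borel \<Otimes>\<^sub>M borel)"
    and "d \<in> M \<rightarrow>\<^sub>M P" "x \<in> borel_measurable M" "u \<in> borel_measurable M"
  shows "(\<lambda>p. f (d p) (x p) (u p)) \<in> borel_measurable M"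
  using measurable_compose[OF _ f, of "\<lambda>p. (d p, x p, u p)" M] assms by simp

text \<open>The prediction at step i reads only inputs with index below i, so
  \<open>i \<le> N\<close> keeps to the indices where the solution is measurable.\<close>

lemma measurable_predicted:
  fixes f :: "'d \<Rightarrow> real^'n \<Rightarrow> real^'m \<Rightarrow> real^'n"
  assumes f: "(\<lambda>(d, x, u). f d x u) \<in> borel_measurable (P \<Otimes>\<^sub>M borel \<Otimes>\<^sub>M borel)"
    and sol: "\<And>i. i < N \<Longrightarrow>
      (\<lambda>(x, om). input (sol x om) i) \<in> borel_measurable (borel \<Otimes>\<^sub>M scenario_space P N K)"
    and k: "k \<in> {1..K}" and i: "i \<le> N"
  shows "(\<lambda>p. predicted f (snd p) k (fst p) (sol (fst p) (snd p)) i)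
    \<in> borel_measurable (borel \<Otimes>\<^sub>M scenario_space P N K)"
  using i
proof (induction i)
  case (Suc i)
  have "(\<lambda>om. om (k, i)) \<in> scenario_space P N K \<rightarrow>\<^sub>M P"
    unfolding scenario_space_def using k Suc.prems by (intro measurable_component_singleton) auto
  from measurable_compose[OF measurable_snd this] show ?case
    using Suc sol[of i] by (auto simp: case_prod_beta' intro!: measurable_dynamics[OF f])
qed simp

lemma predicted_cong:
  assumes "\<And>i. i < n \<Longrightarrow> input u i = input v i"
  shows "predicted f om k x u n = predicted f om k x v n"
  using assms by (induction n) simp_all

text \<open>
  Replaces the existential quantifier over inputs by a test of the solution itself, which makes
  feasibility measurable without a projection theorem.  The solution is only tested on indices
  below \<open>N\<close>, where it is known to be measurable.
\<close>

lemma fhscp_feasible_iff_solution: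
  assumes "scenario_solution P f X U l N K rem sol" and "removal_algorithm P N K R rem"
    and om: "om \<in> space (scenario_space P N K)"
  shows "fhscp_feasible f X U N rem x om \<noteq> {} \<longleftrightarrow>
    (\<forall>i<N. input (sol x om) i \<in> U) \<and>
    (\<forall>k\<in>{1..K}. k \<in> rem x om \<longrightarrow> (\<forall>i<N. predicted f om k x (sol x om) (Suc i) \<in> X))"
    (is "_ \<longleftrightarrow> ?R")
proof
  assume "fhscp_feasible f X U N rem x om \<noteq> {}"
  then have "sol x om \<in> fhscp_feasible f X U N rem x om"
    using assms by (auto simp: scenario_solution_def fhscp_optimal_def)
  then show ?R by (auto simp: fhscp_feasible_def)
next
  assume R: ?R
  \<comment> \<open>In this direction feasibility is not yet known, so \<open>sol x om\<close> may
    be an arbitrary default outside the decision space. Truncation at \<open>N\<close> repairs that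
    without changing any prediction up to step \<open>N\<close>.\<close>
  define v where "v = Abs_poly_mapping (\<lambda>i. if i < N then input (sol x om) i else 0)"
  have v: "input v i = (if i < N then input (sol x om) i else 0)" for i
  proof -
    have "finite {i. (if i < N then input (sol x om) i else 0) \<noteq> 0}"
      by (rule finite_subset[of _ "{..<N}"]) (auto split: if_splits)
    then show ?thesis by (simp add: v_def lookup_Abs_poly_mapping)
  qed
  have "rem x om \<subseteq> {1..K}"
    using assms by (auto simp: removal_algorithm_def)
  moreover have "predicted f om k x v (Suc i) = predicted f om k x (sol x om) (Suc i)" if "i < N" for k i
    using that by (intro predicted_cong) (simp add: v)
  ultimately have "v \<in> fhscp_feasible f X U N rem x om"
    using R unfolding fhscp_feasible_def mem_decision_space by (auto simp: v simp del: predicted.simps)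
  then show "fhscp_feasible f X U N rem x om \<noteq> {}" by blast
qed

text \<open>Needed to apply Fubini to the event of feasibility. Testing the solution leaves finitely
  many conditions: the quantifier over the kept scenarios runs over the fixed set
  \<open>{1..K}\<close>, guarded by membership in \<open>rem\<close>, which is measurable because
  \<open>rem\<close> has values in a discrete space.\<close>

lemma measurable_fhscp_feasible:
  fixes f :: "'d \<Rightarrow> real^'n \<Rightarrow> real^'m \<Rightarrow> real^'n"
  assumes f: "(\<lambda>(d, x, u). f d x u) \<in> borel_measurable (P \<Otimes>\<^sub>M borel \<Otimes>\<^sub>M borel)"
    and sol: "scenario_solution P f X U l N K rem sol" and rem: "removal_algorithm P N K R rem"
    and [measurable]: "X \<in> sets borel" "U \<in> sets borel"
  shows "{p \<in> space (borel \<Otimes>\<^sub>M scenario_space P N K). fhscp_feasible f X U N rem (fst p) (snd p) \<noteq> {}}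
    \<in> sets (borel \<Otimes>\<^sub>M scenario_space P N K)"
proof -
  let ?M = "borel \<Otimes>\<^sub>M scenario_space P N K"
  have sol_meas: "(\<lambda>(x, om). input (sol x om) i) \<in> borel_measurable ?M" if "i < N" for i
    using sol that by (simp add: scenario_solution_def)
  have [measurable]: "Measurable.pred ?M (\<lambda>p. input (sol (fst p) (snd p)) i \<in> U)" if "i < N" for i
    using sol_meas[OF that] by (intro pred_sets2) (simp_all add: case_prod_beta')
  have [measurable]: "Measurable.pred ?M (\<lambda>p. k \<in> rem (fst p) (snd p))" if "k \<in> {1..K}" for k
  proof -
    have "(\<lambda>p. rem (fst p) (snd p)) \<in> ?M \<rightarrow>\<^sub>M count_space (Pow {1..K})"
      using rem by (simp add: removal_algorithm_def case_prod_beta')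
    from measurable_compose[OF this, of "\<lambda>A. k \<in> A" "count_space UNIV"] show ?thesis by simp
  qed
  have [measurable]: "Measurable.pred ?M
      (\<lambda>p. predicted f (snd p) k (fst p) (sol (fst p) (snd p)) (Suc i) \<in> X)"
    if "k \<in> {1..K}" "i < N" for k i
    using measurable_predicted[OF f sol_meas that(1), of "Suc i"] that(2)
    by (intro pred_sets2[where A = X and N = borel]) (simp_all del: predicted.simps)
  have "{p \<in> space ?M. fhscp_feasible f X U N rem (fst p) (snd p) \<noteq> {}} =
      {p \<in> space ?M. (\<forall>i\<in>{..<N}. input (sol (fst p) (snd p)) i \<in> U) \<and>
        (\<forall>k\<in>{1..K}. k \<in> rem (fst p) (snd p) \<longrightarrow>
          (\<forall>i\<in>{..<N}. predicted f (snd p) k (fst p) (sol (fst p) (snd p)) (Suc i) \<in> X))}"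
    using fhscp_feasible_iff_solution[OF sol rem]
    by (intro Collect_cong conj_cong refl) (simp add: space_pair_measure mem_Times_iff lessThan_iff Ball_def del: predicted.simps)
  also have "\<dots> \<in> sets ?M"
  proof -
    have "Measurable.pred ?M (\<lambda>p. (\<forall>i\<in>{..<N}. input (sol (fst p) (snd p)) i \<in> U) \<and>
        (\<forall>k\<in>{1..K}. k \<in> rem (fst p) (snd p) \<longrightarrow>
          (\<forall>i\<in>{..<N}. predicted f (snd p) k (fst p) (sol (fst p) (snd p)) (Suc i) \<in> X)))"
      by (intro pred_intros_logic pred_intros_finite) (auto simp del: predicted.simps)
    then show ?thesis by (simp add: pred_def)
  qed
  finally show ?thesis .
qed

section \<open>The state as a function of the earlier draws\<close>

primrec draw_time :: "draw \<Rightarrow> nat"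
  where "draw_time (Plant t) = t" | "draw_time (Sample t k i) = t"

definition past_draws :: "nat \<Rightarrow> nat \<Rightarrow> nat \<Rightarrow> draw set"
  where "past_draws N K t = {j \<in> draws N K. draw_time j < t}"

text \<open>\<open>Plant t\<close> is kept apart: the input at time t may depend on the samples of
  that time, but not on the plant uncertainty.\<close>

definition sample_draws :: "nat \<Rightarrow> nat \<Rightarrow> nat \<Rightarrow> draw set"
  where "sample_draws N K t = {Sample t k i | k i. k \<in> {1..K} \<and> i < N}"

lemma drawn_scenarios_cong:
  assumes "\<And>j. j \<in> sample_draws N K t \<Longrightarrow> \<delta> j s = \<delta>' j s'"
  shows "drawn_scenarios N K \<delta> t s = drawn_scenarios N K \<delta>' t s'"
  using assms unfolding drawn_scenarios_def sample_draws_def by (intro restrict_ext) auto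

lemma measurable_drawn_scenarios:
  assumes "\<And>j. j \<in> sample_draws N K t \<Longrightarrow> \<delta> j \<in> M \<rightarrow>\<^sub>M P"
  shows "drawn_scenarios N K \<delta> t \<in> M \<rightarrow>\<^sub>M scenario_space P N K"
  unfolding drawn_scenarios_def scenario_space_def
  by (rule measurable_restrict) (auto intro!: assms simp: sample_draws_def)

lemma scmpc_state_Suc:
  "scmpc_state f sol N K x0 \<delta> (Suc t) s =
    f (\<delta> (Plant t) s) (scmpc_state f sol N K x0 \<delta> t s)
      (input (sol (scmpc_state f sol N K x0 \<delta> t s) (drawn_scenarios N K \<delta> t s)) 0)"
  by (simp add: scmpc_state_def)

lemma past_draws_Suc:
  "past_draws N K (Suc t) = insert (Plant t) (sample_draws N K t \<union> past_draws N K t)"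
  by (auto simp: past_draws_def sample_draws_def draws_def less_Suc_eq)

text \<open>The two families may live on different sample spaces. With
  \<open>\<delta>' j y = y j\<close> this evaluates the closed loop on the product space of past
  draws, which exhibits the state as a function of the past.\<close>

lemma scmpc_state_cong:
  assumes "\<And>j. j \<in> past_draws N K t \<Longrightarrow> \<delta> j s = \<delta>' j s'"
  shows "scmpc_state f sol N K x0 \<delta> t s = scmpc_state f sol N K x0 \<delta>' t s'"
  using assms
proof (induction t)
  case (Suc t)
  then show ?case
    using drawn_scenarios_cong[of N K t \<delta> s \<delta>' s'] by (simp add: scmpc_state_Suc past_draws_Suc)
qed (simp add: scmpc_state_def)

text \<open>Measurability is required of the past draws alone, so that the lemma serves both for the
  given random variables and for the coordinates of the product over the past.\<close>

lemma measurable_scmpc_state: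
  fixes f :: "'d \<Rightarrow> real^'n \<Rightarrow> real^'m \<Rightarrow> real^'n"
  assumes f: "(\<lambda>(d, x, u). f d x u) \<in> borel_measurable (P \<Otimes>\<^sub>M borel \<Otimes>\<^sub>M borel)"
    and sol: "(\<lambda>(x, om). input (sol x om) 0) \<in> borel_measurable (borel \<Otimes>\<^sub>M scenario_space P N K)"
    and "\<And>j. j \<in> past_draws N K t \<Longrightarrow> \<delta> j \<in> M \<rightarrow>\<^sub>M P"
  shows "scmpc_state f sol N K x0 \<delta> t \<in> borel_measurable M"
  using assms(3)
proof (induction t)
  case 0
  then show ?case by (simp add: scmpc_state_def)
next
  case (Suc t)
  have [measurable]: "scmpc_state f sol N K x0 \<delta> t \<in> borel_measurable M"
      "\<delta> (Plant t) \<in> M \<rightarrow>\<^sub>M P" "drawn_scenarios N K \<delta> t \<in> M \<rightarrow>\<^sub>M scenario_space P N K"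
    using Suc by (auto simp: past_draws_Suc intro: measurable_drawn_scenarios)
  have "(\<lambda>s. (\<lambda>(x, om). input (sol x om) 0)
      (scmpc_state f sol N K x0 \<delta> t s, drawn_scenarios N K \<delta> t s)) \<in> borel_measurable M"
    by (rule measurable_compose[OF _ sol]) measurable
  then show ?case
    unfolding scmpc_state_Suc by (intro measurable_dynamics[OF f]) simp_all
qed

section \<open>The expected violation probability at a fixed state\<close>

text \<open>At a fixed state, the violation probability is the measure of a slice of the violation
  event in scenarios and plant uncertainty, so its mean is the product measure of that
  event.\<close>

lemma emeasure_violation_le:
  fixes f :: "'d \<Rightarrow> real^'n \<Rightarrow> real^'m \<Rightarrow> real^'n"
  assumes P: "prob_space P"
    and f: "(\<lambda>(d, x, u). f d x u) \<in> borel_measurable (P \<Otimes>\<^sub>M borel \<Otimes>\<^sub>M borel)"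
    and sol: "(\<lambda>(x, om). input (sol x om) 0) \<in> borel_measurable (borel \<Otimes>\<^sub>M scenario_space P N K)"
    and X: "X \<in> sets borel"
    and le: "(\<integral>om. violation_prob P f X sol x om \<partial>scenario_space P N K) \<le> \<epsilon>"
  shows "emeasure (scenario_space P N K \<Otimes>\<^sub>M P)
    {p \<in> space (scenario_space P N K \<Otimes>\<^sub>M P). f (snd p) x (input (sol x (fst p)) 0) \<notin> X} \<le> ennreal \<epsilon>"
proof -
  interpret P: prob_space P by fact
  interpret prob_space "scenario_space P N K"
    unfolding scenario_space_def by (rule prob_space_PiM) (rule P)
  let ?\<Sigma> = "scenario_space P N K"
  let ?E = "{p \<in> space (?\<Sigma> \<Otimes>\<^sub>M P). f (snd p) x (input (sol x (fst p)) 0) \<notin> X}"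
  have [measurable]: "(\<lambda>om. input (sol x om) 0) \<in> borel_measurable ?\<Sigma>"
    using measurable_compose[OF measurable_Pair1' sol, of x] by simp
  have "(\<lambda>p. f (snd p) x (input (sol x (fst p)) 0)) \<in> borel_measurable (?\<Sigma> \<Otimes>\<^sub>M P)"
    by (intro measurable_dynamics[OF f]) measurable
  then have E[measurable]: "?E \<in> sets (?\<Sigma> \<Otimes>\<^sub>M P)"
    using X by measurable
  have slice: "emeasure P (Pair om -` ?E) = ennreal (violation_prob P f X sol x om)"
    if "om \<in> space ?\<Sigma>" for om
    using that unfolding violation_prob_def P.emeasure_eq_measure
    by (intro arg_cong[where f = ennreal] arg_cong[where f = "measure P"]) (auto simp: space_pair_measure)
  \<comment> \<open>The assumed bound concerns a Bochner integral, which is 0 by default for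
    non-integrable functions; integrability is what allows passing to the nonnegative
    integral.\<close>
  have "integrable ?\<Sigma> (violation_prob P f X sol x)"
  proof (rule integrable_const_bound[of _ 1])
    have "(\<lambda>om. measure P (Pair om -` ?E)) \<in> borel_measurable ?\<Sigma>"
      unfolding measure_def using P.measurable_emeasure_Pair[OF E] by measurable
    also have "?this \<longleftrightarrow> violation_prob P f X sol x \<in> borel_measurable ?\<Sigma>"
      using slice by (intro measurable_cong) (simp add: P.emeasure_eq_measure violation_prob_def)
    finally show "violation_prob P f X sol x \<in> borel_measurable ?\<Sigma>" .
  qed (simp add: violation_prob_def)
  moreover have "emeasure (?\<Sigma> \<Otimes>\<^sub>M P) ?E = (\<integral>\<^sup>+om. ennreal (violation_prob P f X sol x om) \<partial>?\<Sigma>)"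
    by (subst P.emeasure_pair_measure_alt[OF E]) (intro nn_integral_cong slice)
  moreover have "0 \<le> violation_prob P f X sol x om" for om
    by (simp add: violation_prob_def)
  ultimately show ?thesis
    using le by (simp add: nn_integral_eq_integral ennreal_leI)
qed

section \<open>Independence of past and present draws\<close>

context prob_space
begin

lemma distr_restrict_eq_PiM:
  assumes "indep_vars (\<lambda>_. P) \<delta> J" "J \<noteq> {}" "\<And>j. j \<in> J \<Longrightarrow> distr M P (\<delta> j) = P"
  shows "distr M (PiM J (\<lambda>_. P)) (\<lambda>s. \<lambda>j\<in>J. \<delta> j s) = PiM J (\<lambda>_. P)"
proof -
  have "distr M (PiM J (\<lambda>_. P)) (\<lambda>s. \<lambda>j\<in>J. \<delta> j s) = PiM J (\<lambda>j. distr M P (\<delta> j))"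
    using assms(1,2) by (subst indep_vars_iff_distr_eq_PiM'[symmetric]) (auto simp: indep_vars_def)
  also have "\<dots> = PiM J (\<lambda>_. P)"
    by (intro PiM_cong refl assms(3))
  finally show ?thesis .
qed

lemma distr_drawn_scenarios:
  assumes P: "prob_space P" and indep: "indep_vars (\<lambda>_. P) \<delta> (draws N K)"
    and law: "\<And>j. j \<in> draws N K \<Longrightarrow> distr M P (\<delta> j) = P"
  shows "distr M (scenario_space P N K) (drawn_scenarios N K \<delta> t) = scenario_space P N K"
proof -
  let ?I = "{1..K} \<times> {..<N}" and ?J = "draws N K"
  let ?g = "\<lambda>(k, i). Sample t k i"
  have rv: "(\<lambda>s. \<lambda>j\<in>?J. \<delta> j s) \<in> M \<rightarrow>\<^sub>M PiM ?J (\<lambda>_. P)"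
    using indep by (intro measurable_restrict) (auto simp: indep_vars_def)
  \<comment> \<open>Passing through the family of all draws covers \<open>K = 0\<close>: there are
    then no samples, but the plant uncertainties keep the index set nonempty.\<close>
  have J: "?J \<noteq> {}" by (auto simp: draws_def)
  have g: "inj_on ?g ?I" "?g \<in> ?I \<rightarrow> ?J"
    by (auto simp: inj_on_def draws_def)
  have reindex: "(\<lambda>y. \<lambda>p\<in>?I. y (?g p)) \<in> PiM ?J (\<lambda>_. P) \<rightarrow>\<^sub>M PiM ?I (\<lambda>_. P)"
    by (intro measurable_restrict measurable_component_singleton) (auto simp: draws_def)
  have "distr M (scenario_space P N K) (drawn_scenarios N K \<delta> t) =
      distr M (PiM ?I (\<lambda>_. P)) ((\<lambda>y. \<lambda>p\<in>?I. y (?g p)) \<circ> (\<lambda>s. \<lambda>j\<in>?J. \<delta> j s))"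
    unfolding scenario_space_def drawn_scenarios_def
    by (intro distr_cong refl) (auto simp: fun_eq_iff draws_def restrict_def)
  also have "\<dots> = distr (PiM ?J (\<lambda>_. P)) (PiM ?I (\<lambda>_. P)) (\<lambda>y. \<lambda>p\<in>?I. y (?g p))"
    by (simp only: distr_distr[OF reindex rv, symmetric] distr_restrict_eq_PiM[OF indep J law])
  also have "\<dots> = scenario_space P N K"
    using distr_PiM_reindex[of ?J "\<lambda>_. P" ?g ?I] P g by (simp add: scenario_space_def)
  finally show ?thesis .
qed

lemma indep_var_joint_distr:
  assumes indep: "indep_var S X T Y" and [measurable]: "f \<in> S \<rightarrow>\<^sub>M S'" "g \<in> T \<rightarrow>\<^sub>M T'"
  shows "distr M (S' \<Otimes>\<^sub>M T') (\<lambda>s. (f (X s), g (Y s))) =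
    distr M S' (\<lambda>s. f (X s)) \<Otimes>\<^sub>M distr M T' (\<lambda>s. g (Y s))"
proof -
  have [measurable]: "X \<in> M \<rightarrow>\<^sub>M S" "Y \<in> M \<rightarrow>\<^sub>M T"
    using indep by (auto dest: indep_var_rv1 indep_var_rv2)
  interpret Y: prob_space "distr M T' (\<lambda>s. g (Y s))" by (rule prob_space_distr) simp
  have "distr M S' (\<lambda>s. f (X s)) \<Otimes>\<^sub>M distr M T' (\<lambda>s. g (Y s)) =
      distr (distr M S X) S' f \<Otimes>\<^sub>M distr (distr M T Y) T' g"
    by (simp add: distr_distr comp_def)
  also have "\<dots> = distr (distr M S X \<Otimes>\<^sub>M distr M T Y) (S' \<Otimes>\<^sub>M T') (\<lambda>(x, y). (f x, g y))"
    using Y.sigma_finite_measure_axioms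
    by (intro pair_measure_distr) (simp_all add: distr_distr comp_def)
  also have "\<dots> = distr (distr M (S \<Otimes>\<^sub>M T) (\<lambda>s. (X s, Y s))) (S' \<Otimes>\<^sub>M T') (\<lambda>(x, y). (f x, g y))"
    using indep by (simp add: indep_var_distribution_eq)
  also have "\<dots> = distr M (S' \<Otimes>\<^sub>M T') (\<lambda>s. (f (X s), g (Y s)))"
    by (simp add: distr_distr comp_def)
  finally show ?thesis ..
qed

text \<open>Past draws, samples of time t and \<open>Plant t\<close> have disjoint indices. Grouping
  first separates samples from plant, giving the law of \<open>Z t\<close>, and then past from
  present. The second claim serves the violation event; the third serves feasibility, which does not
  involve the plant uncertainty.\<close>

lemma joint_distr_past_present:
  assumes P: "prob_space P" and indep: "indep_vars (\<lambda>_. P) \<delta> (draws N K)"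
    and law: "\<And>j. j \<in> draws N K \<Longrightarrow> distr M P (\<delta> j) = P"
  defines "W \<equiv> \<lambda>t s. \<lambda>j\<in>past_draws N K t. \<delta> j s"
    and "Z \<equiv> \<lambda>t s. (drawn_scenarios N K \<delta> t s, \<delta> (Plant t) s)"
  shows "distr M (scenario_space P N K \<Otimes>\<^sub>M P) (Z t) = scenario_space P N K \<Otimes>\<^sub>M P" (is ?law)
    and "distr M (PiM (past_draws N K t) (\<lambda>_. P) \<Otimes>\<^sub>M (scenario_space P N K \<Otimes>\<^sub>M P)) (\<lambda>s. (W t s, Z t s)) =
      distr M (PiM (past_draws N K t) (\<lambda>_. P)) (W t) \<Otimes>\<^sub>M (scenario_space P N K \<Otimes>\<^sub>M P)" (is ?joint)
    and "distr M (PiM (past_draws N K t) (\<lambda>_. P) \<Otimes>\<^sub>M scenario_space P N K)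
        (\<lambda>s. (W t s, drawn_scenarios N K \<delta> t s)) =
      distr M (PiM (past_draws N K t) (\<lambda>_. P)) (W t) \<Otimes>\<^sub>M scenario_space P N K" (is ?joint')
proof -
  let ?Past = "past_draws N K t" and ?S = "sample_draws N K t"
  let ?F = "insert (Plant t) ?S"
  let ?r = "\<lambda>J s. \<lambda>j\<in>J. \<delta> j s"
  have sub: "?Past \<inter> ?F = {}" "?Past \<subseteq> draws N K" "?F \<subseteq> draws N K"
      "?S \<inter> {Plant t} = {}" "?S \<subseteq> draws N K" "{Plant t} \<subseteq> draws N K"
    by (auto simp: past_draws_def sample_draws_def draws_def)
  \<comment> \<open>Taking coordinates as the random variables turns the drawn scenarios into a
    measurable function of any block of draws containing the samples of time t.\<close>
  have drawn: "drawn_scenarios N K (\<lambda>j y. y j) t \<in> PiM J (\<lambda>_. P) \<rightarrow>\<^sub>M scenario_space P N K"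
    if "?S \<subseteq> J" for J
    using that by (intro measurable_drawn_scenarios) (auto intro: measurable_component_singleton)
  have drawn_eq: "drawn_scenarios N K (\<lambda>j y. y j) t (?r J s) = drawn_scenarios N K \<delta> t s"
    if "?S \<subseteq> J" for J s
    using that by (intro drawn_scenarios_cong) auto
  have law': "distr M (scenario_space P N K) (drawn_scenarios N K \<delta> t) = scenario_space P N K"
    by (rule distr_drawn_scenarios) fact+
  have "distr M P (\<delta> (Plant t)) = P"
    using law by (simp add: draws_def)
  with law' show law_Z: ?law
    using indep_var_joint_distr[OF indep_var_restrict[OF indep sub(4,5,6)] drawn[OF order_refl]
        measurable_component_singleton[of "Plant t"]] drawn_eq[of ?S]
    unfolding Z_def by simp
  have Z: "(\<lambda>y. (drawn_scenarios N K (\<lambda>j y. y j) t y, y (Plant t)))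
      \<in> PiM ?F (\<lambda>_. P) \<rightarrow>\<^sub>M scenario_space P N K \<Otimes>\<^sub>M P"
    by (intro measurable_Pair drawn measurable_component_singleton) auto
  note present = indep_var_joint_distr[OF indep_var_restrict[OF indep sub(1,2,3)] measurable_ident]
  show ?joint
    using present[OF Z] drawn_eq[of ?F] law_Z unfolding Z_def W_def by (simp add: subset_insertI id_def)
  show ?joint'
    using present[OF drawn[OF subset_insertI]] drawn_eq[of ?F] law'
    unfolding W_def by (simp add: subset_insertI id_def)
qed

end

section \<open>The violation frequency of the closed loop\<close>

theorem theorem17:
  fixes P :: "'d measure" and S :: "'s measure" and \<delta> :: "draw \<Rightarrow> 's \<Rightarrow> 'd"
    and A :: "'d \<Rightarrow> real^'n^'n" and B :: "'d \<Rightarrow> real^'m^'n" and w :: "'d \<Rightarrow> real^'n"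
    and x0 :: "real^'n" and X :: "(real^'n) set" and U :: "(real^'m) set"
    and l :: "(real^'n) \<times> (real^'m) \<Rightarrow> real"
    and N K R :: nat and \<epsilon> :: real
    and rem :: "real^'n \<Rightarrow> 'd scenarios \<Rightarrow> nat set"
    and sol :: "real^'n \<Rightarrow> 'd scenarios \<Rightarrow> 'm inputs"
  assumes "prob_space P" and "prob_space S"
    and "prob_space.indep_vars S (\<lambda>_. P) \<delta> (draws N K)"
    and "\<And>j. j \<in> draws N K \<Longrightarrow> distr S P (\<delta> j) = P"
    and "A \<in> borel_measurable P" and "B \<in> borel_measurable P" and "w \<in> borel_measurable P"
    and "N \<ge> 1"
    and "bounded U" and "convex U" and "U \<in> sets borel"
    and "convex X" and "X \<in> sets borel"
    and "convex_on UNIV l" and "\<And>z. l z \<ge> 0"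
    and "removal_algorithm P N K R rem"
    and "scenario_solution P (affine_step A B w) X U l N K rem sol"
    and resolvability:
      "AE s in S. \<forall>t. fhscp_feasible (affine_step A B w) X U N rem
        (scmpc_state (affine_step A B w) sol N K x0 \<delta> t s) (drawn_scenarios N K \<delta> t s) \<noteq> {}"
    and "0 < \<epsilon>" and "\<epsilon> < 1/2"
    and "admissible_pair P (affine_step A B w) X U N rem sol \<epsilon> K R"
  shows "AE s in S.
    limsup (\<lambda>T. ereal (1 / real T *
      (\<Sum>t<T. indicator (- X) (scmpc_state (affine_step A B w) sol N K x0 \<delta> (Suc t) s)))) \<le> ereal \<epsilon>"
proof -
  interpret P: prob_space P by fact
  interpret S: prob_space S by fact
  note law = \<open>\<And>j. j \<in> draws N K \<Longrightarrow> distr S P (\<delta> j) = P\<close>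
    and [measurable] = \<open>A \<in> borel_measurable P\<close> \<open>B \<in> borel_measurable P\<close> \<open>w \<in> borel_measurable P\<close>
      \<open>X \<in> sets borel\<close> \<open>U \<in> sets borel\<close>
  let ?f = "affine_step A B w" and ?\<Sigma> = "scenario_space P N K"
  let ?Past = "past_draws N K" and ?\<Pi> = "\<lambda>t. PiM (past_draws N K t) (\<lambda>_. P)"
  \<comment> \<open>The closed loop run on a point y of the space of draws; \<open>?y t\<close> is
    the state as a function of the past.\<close>
  let ?y = "scmpc_state ?f sol N K x0 (\<lambda>j y. y j)"
  let ?Z = "\<lambda>t s. (drawn_scenarios N K \<delta> t s, \<delta> (Plant t) s)"
  interpret \<Sigma>: prob_space ?\<Sigma>
    unfolding scenario_space_def by (rule prob_space_PiM) (rule P.prob_space_axioms)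
  define x where "x = scmpc_state ?f sol N K x0 \<delta>"
  define W where "W t s = (\<lambda>j\<in>?Past t. \<delta> j s)" for t s
  have f: "(\<lambda>(d, x, u). ?f d x u) \<in> borel_measurable (P \<Otimes>\<^sub>M borel \<Otimes>\<^sub>M borel)"
    by measurable
  have sol0: "(\<lambda>(x, om). input (sol x om) 0) \<in> borel_measurable (borel \<Otimes>\<^sub>M ?\<Sigma>)"
    using \<open>scenario_solution P ?f X U l N K rem sol\<close> \<open>N \<ge> 1\<close> by (simp add: scenario_solution_def)
  have rv: "\<delta> j \<in> S \<rightarrow>\<^sub>M P" if "j \<in> draws N K" for j
    using \<open>S.indep_vars (\<lambda>_. P) \<delta> (draws N K)\<close> that by (auto simp: S.indep_vars_def)
  have past_sub: "?Past t \<subseteq> draws N K" for t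
    by (auto simp: past_draws_def)
  have x_meas[measurable]: "x t \<in> borel_measurable S" for t
    unfolding x_def using past_sub by (intro measurable_scmpc_state[OF f sol0]) (auto intro: rv)
  \<comment> \<open>All states up to and including time t are read off the past of t. Hence so are
    the violations counted in \<open>g\<close>: the one with index i < t concerns the state at
    \<open>Suc i \<le> t\<close>.\<close>
  have y_meas[measurable]: "?y i \<in> borel_measurable (?\<Pi> t)" if "i \<le> t" for i t
    using that
    by (intro measurable_scmpc_state[OF f sol0] measurable_component_singleton) (auto simp: past_draws_def)
  have y_W: "?y i (W t s) = x i s" if "i \<le> t" for i t s
    unfolding x_def using that by (intro scmpc_state_cong) (auto simp: W_def past_draws_def)
  have W_meas[measurable]: "W t \<in> S \<rightarrow>\<^sub>M ?\<Pi> t" for t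
    unfolding W_def using past_sub by (intro measurable_restrict rv) auto
  have drawn[measurable]: "drawn_scenarios N K \<delta> t \<in> S \<rightarrow>\<^sub>M ?\<Sigma>" for t
    by (intro measurable_drawn_scenarios rv) (auto simp: sample_draws_def draws_def)
  have [measurable]: "\<delta> (Plant t) \<in> S \<rightarrow>\<^sub>M P" for t
    by (intro rv) (simp add: draws_def)
  have joint:
      "distr S (?\<Sigma> \<Otimes>\<^sub>M P) (?Z t) = ?\<Sigma> \<Otimes>\<^sub>M P"
      "distr S (?\<Pi> t \<Otimes>\<^sub>M (?\<Sigma> \<Otimes>\<^sub>M P)) (\<lambda>s. (W t s, ?Z t s)) = distr S (?\<Pi> t) (W t) \<Otimes>\<^sub>M (?\<Sigma> \<Otimes>\<^sub>M P)"
      "distr S (?\<Pi> t \<Otimes>\<^sub>M ?\<Sigma>) (\<lambda>s. (W t s, drawn_scenarios N K \<delta> t s)) = distr S (?\<Pi> t) (W t) \<Otimes>\<^sub>M ?\<Sigma>"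
    for t
    unfolding W_def by (rule S.joint_distr_past_present; fact P.prob_space_axioms assms(3) law)+
  define E where "E t = {s \<in> space S. x (Suc t) s \<notin> X}" for t
  have E[measurable]: "E t \<in> sets S" for t
    unfolding E_def by measurable
  have "AE s in S. limsup (\<lambda>T. ereal (1 / real T * (\<Sum>t<T. indicator (E t) s))) \<le> ereal \<epsilon>"
  proof (rule S.AE_limsup_frequency_le[OF E])
    fix t and a :: real
    define G where "G = {p \<in> space (?\<Pi> t \<Otimes>\<^sub>M (?\<Sigma> \<Otimes>\<^sub>M P)).
      ?f (snd (snd p)) (?y t (fst p)) (input (sol (?y t (fst p)) (fst (snd p))) 0) \<notin> X}"
    define g :: "(draw \<Rightarrow> 'd) \<Rightarrow> ennreal"
      where "g y = ennreal (exp (a * (\<Sum>i<t. indicator (- X) (?y (Suc i) y))))" for y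
    have [measurable]: "?y t \<in> borel_measurable (?\<Pi> t)"
      by (rule y_meas) simp
    have [measurable]: "(\<lambda>p. input (sol (?y t (fst p)) (fst (snd p))) 0)
        \<in> borel_measurable (?\<Pi> t \<Otimes>\<^sub>M (?\<Sigma> \<Otimes>\<^sub>M P))"
      using measurable_compose[OF _ sol0, of "\<lambda>p. (?y t (fst p), fst (snd p))" "?\<Pi> t \<Otimes>\<^sub>M (?\<Sigma> \<Otimes>\<^sub>M P)"]
      by simp
    have G: "G \<in> sets (?\<Pi> t \<Otimes>\<^sub>M (?\<Sigma> \<Otimes>\<^sub>M P))"
      unfolding G_def by measurable
    have g: "g \<in> borel_measurable (?\<Pi> t)"
      unfolding g_def by measurable
    have feasible_sets: "{p \<in> space (?\<Pi> t \<Otimes>\<^sub>M ?\<Sigma>).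
        fhscp_feasible ?f X U N rem (?y t (fst p)) (snd p) \<noteq> {}} \<in> sets (?\<Pi> t \<Otimes>\<^sub>M ?\<Sigma>)"
    proof -
      have "Measurable.pred (borel \<Otimes>\<^sub>M ?\<Sigma>) (\<lambda>p. fhscp_feasible ?f X U N rem (fst p) (snd p) \<noteq> {})"
        unfolding pred_def by (rule measurable_fhscp_feasible[OF f]) fact+
      from measurable_compose[OF _ this, of "\<lambda>p. (?y t (fst p), snd p)" "?\<Pi> t \<Otimes>\<^sub>M ?\<Sigma>"]
      show ?thesis by (simp add: pred_def)
    qed
    interpret W: prob_space "distr S (?\<Pi> t) (W t)"
      by (rule S.prob_space_distr) simp
    interpret W\<Sigma>: pair_prob_space "distr S (?\<Pi> t) (W t)" ?\<Sigma> ..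
    \<comment> \<open>Resolvability is moved to the joint law of past and scenarios. That law is a
      product, so for almost every past the program is feasible for almost all fresh scenarios,
      which is the premise of admissibility.\<close>
    have "AE s in S. fhscp_feasible ?f X U N rem (?y t (W t s)) (drawn_scenarios N K \<delta> t s) \<noteq> {}"
      using resolvability by eventually_elim (simp add: y_W x_def)
    then have "AE p in distr S (?\<Pi> t \<Otimes>\<^sub>M ?\<Sigma>) (\<lambda>s. (W t s, drawn_scenarios N K \<delta> t s)).
        fhscp_feasible ?f X U N rem (?y t (fst p)) (snd p) \<noteq> {}"
      by (subst AE_distr_iff[OF _ feasible_sets]) simp_all
    from W\<Sigma>.AE_pair[OF this[unfolded joint(3)]]
    have "AE y in distr S (?\<Pi> t) (W t). AE om in ?\<Sigma>. fhscp_feasible ?f X U N rem (?y t y) om \<noteq> {}"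
      by simp
    then have "AE y in distr S (?\<Pi> t) (W t). emeasure (?\<Sigma> \<Otimes>\<^sub>M P) (Pair y -` G) \<le> ennreal \<epsilon>"
      using AE_space
    proof eventually_elim
      case (elim y)
      \<comment> \<open>The two inequalities of admissibility chain through the integral of
        \<open>U_bound\<close> at the state \<open>?y t y\<close>.\<close>
      have "(\<integral>om. violation_prob P ?f X sol (?y t y) om \<partial>?\<Sigma>) \<le> \<epsilon>"
        using \<open>admissible_pair P ?f X U N rem sol \<epsilon> K R\<close> elim(1)
        unfolding admissible_pair_def by (blast intro: order_trans)
      from emeasure_violation_le[OF P.prob_space_axioms f sol0 \<open>X \<in> sets borel\<close> this]
      show ?case
        using elim(2) by (simp add: G_def space_pair_measure[of "?\<Pi> t"] vimage_def)
    qed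
    note bound = S.nn_integral_indep_indicator_le[OF W_meas _ joint(2,1) G g this]
    have "(\<integral>\<^sup>+s. g (W t s) * indicator G (W t s, ?Z t s) \<partial>S) \<le> ennreal \<epsilon> * (\<integral>\<^sup>+s. g (W t s) \<partial>S)"
      by (rule bound) measurable
    moreover have "g (W t s) = ennreal (exp (a * (\<Sum>i<t. indicator (E i) s)))" if "s \<in> space S" for s
      unfolding g_def using that
      by (intro arg_cong[where f = "\<lambda>c. ennreal (exp (a * c))"] sum.cong refl)
        (simp add: y_W E_def indicator_def)
    moreover have "indicator G (W t s, ?Z t s) = (indicator (E t) s :: ennreal)" if "s \<in> space S" for s
      using that measurable_space[OF W_meas that] measurable_space[OF drawn that]
        measurable_space[OF rv that, of "Plant t"]
      by (simp add: G_def E_def indicator_def space_pair_measure y_W x_def scmpc_state_Suc draws_def)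
    ultimately show "(\<integral>\<^sup>+s. ennreal (exp (a * (\<Sum>i<t. indicator (E i) s))) * indicator (E t) s \<partial>S)
        \<le> ennreal \<epsilon> * (\<integral>\<^sup>+s. ennreal (exp (a * (\<Sum>i<t. indicator (E i) s))) \<partial>S)"
      by (simp cong: nn_integral_cong)
  qed (use \<open>0 < \<epsilon>\<close> \<open>\<epsilon> < 1/2\<close> in auto)
  then show ?thesis
    using AE_space by eventually_elim (simp add: E_def x_def indicator_def)
qed

end
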